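(* Let $C \in SO(3)$ be any element. Then for $\mu\times\mu$-almost every pair $(A,B) \in SO(3)\times SO(3)$ there is a constant $D=D(A,B)>0$ such that $$\min_{\{\mathcal I_m:\ |\mathcal I_m|=n\}} \|W_{\mathcal I_m}(A,B)-C\|\ \geq\ D^{-n^2}\qquad \text{for all } n \in \mathbb Z_+,$$ where the minimum is over all multi-indices $\mathcal I_m$ (with $m\ge 1$ arbitrary) satisfying $|\mathcal I_m|=n$.
   Context: $\mu$ is the Haar measure on $SO(3)$, and $\mathbb Z_+$ is the set of positive integers. For $m\geq 1$, a multi-index $\mathcal I_m=(s_1,r_1,\dots,s_m,r_m)$ is a $2m$-tuple of nonzero integers (of either sign). Its length is $|\mathcal I_m|=\sum_{p=1}^m(|s_p|+|r_p|)$. The corresponding word is $W_{\mathcal I_m}(A,B)=A^{s_1}B^{r_1}A^{s_2}B^{r_2}\cdots A^{s_m}B^{r_m}\in SO(3)$. $\|\cdot\|$ is a fixed norm on real $3\times 3$ matrices (e.g. the operator norm; the choice does not affect the statement). The minimum over an empty set (the case $n=1$) is taken to be $+\infty$, i.e. the inequality is required for every word with $|\mathcal I_m|=n$. *)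

theory Defs
  imports "HOL-Analysis.Analysis"
begin

definition SO3 :: "(real^3^3) set" where
  "SO3 = {X. rotation_matrix X}"

text \<open>
  \<open>M\<close> is the normalised Haar measure of the compact group \<open>SO3\<close>: a Borel probability
  measure on \<open>SO3\<close> that is invariant under left translations.  Regularity is not
  listed because every finite Borel measure on a compact metric space is regular, and right
  invariance is not listed because it follows for compact groups.
\<close>

definition haar_measure_SO3 :: "(real^3^3) measure \<Rightarrow> bool" where
  "haar_measure_SO3 M \<longleftrightarrow>
     sets M = sets (restrict_space borel SO3) \<and>
     emeasure M SO3 = 1 \<and>
     (\<forall>X\<in>SO3. \<forall>E\<in>sets M. emeasure M ((\<lambda>Y. X ** Y) ` E) = emeasure M E)"

definition norm_on_matrices :: "(real^3^3 \<Rightarrow> real) \<Rightarrow> bool" where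
  "norm_on_matrices N \<longleftrightarrow>
     (\<forall>X. 0 \<le> N X) \<and>
     (\<forall>X. N X = 0 \<longleftrightarrow> X = 0) \<and>
     (\<forall>c X. N (c *\<^sub>R X) = \<bar>c\<bar> * N X) \<and>
     (\<forall>X Y. N (X + Y) \<le> N X + N Y)"

text \<open>
  Powers with respect to the matrix product \<open>**\<close>; the type class operations
  \<open>^\<close> and \<open>powi\<close> are not available for it.
\<close>

definition mat_powi :: "real^3^3 \<Rightarrow> int \<Rightarrow> real^3^3" where
  "mat_powi X k =
     (if 0 \<le> k then ((\<lambda>Y. X ** Y) ^^ nat k) (mat 1)
      else ((\<lambda>Y. matrix_inv X ** Y) ^^ nat (- k)) (mat 1))"

text \<open>
  The multi-index \<open>(s\<^sub>1, r\<^sub>1, \<dots>, s\<^sub>m, r\<^sub>m)\<close> is encoded as the list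
  \<open>[(s\<^sub>1, r\<^sub>1), \<dots>, (s\<^sub>m, r\<^sub>m)]\<close>.
\<close>

definition multi_index :: "(int \<times> int) list \<Rightarrow> bool" where
  "multi_index I \<longleftrightarrow> I \<noteq> [] \<and> (\<forall>(s, r)\<in>set I. s \<noteq> 0 \<and> r \<noteq> 0)"

definition index_length :: "(int \<times> int) list \<Rightarrow> int" where
  "index_length I = (\<Sum>(s, r)\<leftarrow>I. \<bar>s\<bar> + \<bar>r\<bar>)"

fun word :: "(int \<times> int) list \<Rightarrow> real^3^3 \<Rightarrow> real^3^3 \<Rightarrow> real^3^3" where
  "word [] A B = mat 1"
| "word ((s, r) # I) A B = mat_powi A s ** mat_powi B r ** word I A B"

end

theory Submission
  imports Defs "HOL-Computational_Algebra.Fundamental_Theorem_Algebra"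
begin

text \<open>
  Fix a word of length \<open>n\<close> and an entry of \<open>W(A, B) - C\<close>. If \<open>A\<close> is multiplied by a rotation
  about a coordinate axis, the entry becomes a trigonometric polynomial of degree at most \<open>n\<close> in
  the angle, that is, \<open>z\<^sup>-\<^sup>n\<close> times a polynomial of degree at most \<open>2n\<close> in a point \<open>z\<close> of the unit
  circle. Such a function is small only close to a root, so it is small at few points of a
  well-separated finite set, unless it is small on the whole circle. Since a product of three axis
  rotations can be any rotation (Euler angles), moving \<open>A\<close> and \<open>B\<close> by six angles reaches every pair
  in \<open>SO(3) \<times> SO(3)\<close>, and the one-variable count iterates to six variables
  (\<open>card_small_values_multi_le\<close>). All that is needed to start it is one pair at which the entry is
  not too small, say at least \<open>\<delta>\<^sup>n\<close>.

  Such a pair is found in \<open>word_far_from_target\<close>. If \<open>C \<noteq> 1\<close>, the pair \<open>(1, 1)\<close> will do. If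
  \<open>C = 1\<close>, the rotations about two axes with cosine \<open>3/5\<close> and sine \<open>4/5\<close> will do: they generate a
  free group, and a word of length \<open>n\<close> in them has denominator exactly \<open>5\<^sup>n\<close> in some entry.

  Haar measure enters through its invariance alone: a set \<open>E\<close> of pairs has the
  same measure as each of its translates, so \<open>E\<close> has measure at most the largest proportion, over
  all base points, of a finite family of translations that lead into \<open>E\<close>
  (\<open>measure_le_by_averaging\<close>). With \<open>N\<close> points on each circle this gives, for each word, measure at
  most \<open>12n/N\<close> for the set of pairs at which \<open>W(A, B)\<close> is within \<open>\<delta>\<^sup>n (4N + 1)\<^bsup>-12n\<^esup>\<close> of \<open>C\<close>, entry
  by entry. There are at most \<open>3\<^sup>n\<close> words of length \<open>n\<close>, so for \<open>N = L\<^sup>n\<close> the measures sum to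
  \<open>O(1/L)\<close>, while the threshold is at least \<open>D\<^bsup>-n\<^sup>2\<^esup>\<close> with \<open>D\<close> independent of \<open>n\<close>. Letting
  \<open>L\<close> tend to infinity, almost every pair escapes all the exceptional sets of some \<open>L\<close>.
\<close>

section \<open>Small values of trigonometric polynomials\<close>

text \<open>
  On the circle, \<open>g\<close> is a Laurent polynomial with exponents between \<open>-d\<close> and \<open>d\<close>: a trigonometric
  polynomial of degree at most \<open>d\<close>. Multiplying by \<open>z\<^sup>d\<close> makes the theory of complex polynomials
  applicable without changing any modulus.
\<close>

definition laurent_on_circle :: "nat \<Rightarrow> (complex \<Rightarrow> complex) \<Rightarrow> bool" where
  "laurent_on_circle d g \<longleftrightarrow>
     (\<exists>p. degree p \<le> 2 * d \<and> (\<forall>z\<in>sphere 0 1. z ^ d * g z = poly p z))"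

lemma laurent_on_circle_mono:
  assumes "laurent_on_circle d g" "d \<le> e"
  shows "laurent_on_circle e g"
proof -
  obtain p where p: "degree p \<le> 2 * d" "\<forall>z\<in>sphere 0 1. z ^ d * g z = poly p z"
    using assms(1) unfolding laurent_on_circle_def by blast
  have "degree (monom 1 (e - d) * p) \<le> 2 * e"
    using p(1) assms(2) degree_mult_le[of "monom 1 (e - d)" p] degree_monom_le[of "1::complex" "e - d"]
    by linarith
  moreover have "z ^ e * g z = poly (monom 1 (e - d) * p) z" if "z \<in> sphere 0 1" for z
  proof -
    have "z ^ e = z ^ (e - d) * z ^ d" using assms(2) by (simp flip: power_add)
    then have "z ^ e * g z = z ^ (e - d) * (z ^ d * g z)" by (simp only: mult.assoc)
    then show ?thesis using p(2) that by (simp only: poly_mult poly_monom mult_1)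
  qed
  ultimately show ?thesis unfolding laurent_on_circle_def by blast
qed

lemma laurent_on_circle_const: "laurent_on_circle d (\<lambda>_. c)"
proof -
  have "laurent_on_circle 0 (\<lambda>_. c)"
    unfolding laurent_on_circle_def by (intro exI[of _ "[:c:]"]) simp
  then show ?thesis by (rule laurent_on_circle_mono) simp
qed

lemma laurent_on_circle_add:
  assumes "laurent_on_circle d g" "laurent_on_circle d h"
  shows "laurent_on_circle d (\<lambda>z. g z + h z)"
proof -
  obtain p q where p: "degree p \<le> 2 * d" "\<forall>z\<in>sphere 0 1. z ^ d * g z = poly p z"
    and q: "degree q \<le> 2 * d" "\<forall>z\<in>sphere 0 1. z ^ d * h z = poly q z"
    using assms unfolding laurent_on_circle_def by blast
  then show ?thesis
    unfolding laurent_on_circle_def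
    by (intro exI[of _ "p + q"]) (auto simp: distrib_left intro: degree_add_le)
qed

lemma laurent_on_circle_mult:
  assumes "laurent_on_circle d g" "laurent_on_circle e h"
  shows "laurent_on_circle (d + e) (\<lambda>z. g z * h z)"
proof -
  obtain p q where p: "degree p \<le> 2 * d" "\<forall>z\<in>sphere 0 1. z ^ d * g z = poly p z"
    and q: "degree q \<le> 2 * e" "\<forall>z\<in>sphere 0 1. z ^ e * h z = poly q z"
    using assms unfolding laurent_on_circle_def by blast
  have "degree (p * q) \<le> 2 * (d + e)"
    using order_trans[OF degree_mult_le add_mono[OF p(1) q(1)]] by (simp add: distrib_left)
  moreover have "z ^ (d + e) * (g z * h z) = poly (p * q) z" if "z \<in> sphere 0 1" for z
  proof -
    have "z ^ (d + e) * (g z * h z) = (z ^ d * g z) * (z ^ e * h z)"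
      by (simp add: power_add algebra_simps)
    then show ?thesis using p(2) q(2) that by (simp only: poly_mult)
  qed
  ultimately show ?thesis unfolding laurent_on_circle_def by blast
qed

lemma laurent_on_circle_sum:
  assumes "\<And>i. i \<in> S \<Longrightarrow> laurent_on_circle d (g i)"
  shows "laurent_on_circle d (\<lambda>z. \<Sum>i\<in>S. g i z)"
  using assms
  by (induction S rule: infinite_finite_induct)
     (auto intro: laurent_on_circle_const laurent_on_circle_add)

text \<open>
  On the circle \<open>cnj z = 1/z\<close>, so that \<open>Re z = (z + 1/z)/2\<close> and \<open>Im z = (z - 1/z)/(2\<i>)\<close>.
\<close>

lemma laurent_on_circle_Re: "laurent_on_circle 1 (\<lambda>z. of_real (Re z))"
  and laurent_on_circle_Im: "laurent_on_circle 1 (\<lambda>z. of_real (Im z))"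
proof -
  have z: "z * cnj z = 1" if "z \<in> sphere 0 1" for z :: complex
    using that by (simp flip: complex_norm_square)
  have re: "z * of_real (Re z) = poly [:1/2, 0, 1/2:] z" if "z \<in> sphere 0 1" for z
  proof -
    have "z * of_real (Re z) = (z * cnj z + z * z) / 2"
      by (simp add: complex_eq_iff algebra_simps)
    then show ?thesis using z[OF that] by (simp add: algebra_simps add_divide_distrib)
  qed
  have im: "z * of_real (Im z) = poly [:\<i>/2, 0, -\<i>/2:] z" if "z \<in> sphere 0 1" for z
  proof -
    have "z * of_real (Im z) = \<i> * (z * cnj z - z * z) / 2"
      by (simp add: complex_eq_iff algebra_simps)
    then show ?thesis using z[OF that] by (simp add: algebra_simps diff_divide_distrib)
  qed
  show "laurent_on_circle 1 (\<lambda>z. of_real (Re z))"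
    unfolding laurent_on_circle_def using re
    by (intro exI[of _ "[:1/2, 0, 1/2:]"]) simp
  show "laurent_on_circle 1 (\<lambda>z. of_real (Im z))"
    unfolding laurent_on_circle_def using im
    by (intro exI[of _ "[:\<i>/2, 0, -\<i>/2:]"]) simp
qed

text \<open>
  Compare the linear factors one by one: if \<open>z\<close> is at distance at least \<open>\<sigma>\<close> from the root \<open>x\<close>, then
  \<open>|w - x| \<le> 2 + |z - x| \<le> (2/\<sigma> + 1) |z - x|\<close>.
\<close>

lemma poly_lower_bound_off_roots:
  fixes p :: "complex poly"
  assumes \<sigma>: "\<sigma> > 0" and zw: "dist w z \<le> 2"
    and far: "\<And>x. poly p x = 0 \<Longrightarrow> dist z x \<ge> \<sigma>"
  shows "cmod (poly p w) * (\<sigma> / (2 + \<sigma>)) ^ degree p \<le> cmod (poly p z)"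
proof (cases "p = 0")
  case False
  define r where "r = \<sigma> / (2 + \<sigma>)"
  obtain \<rho> where \<rho>: "smult (lead_coeff p) (\<Prod>i<degree p. [:- \<rho> i, 1:]) = p"
    by (rule complex_poly_decompose')
  have ev: "poly p x = lead_coeff p * (\<Prod>i<degree p. x - \<rho> i)" for x
    by (subst \<rho>[symmetric]) (simp add: poly_prod)
  have root: "poly p (\<rho> i) = 0" if "i < degree p" for i
    using that by (auto simp: ev)
  have factor: "cmod (w - \<rho> i) * r \<le> cmod (z - \<rho> i)" if "i < degree p" for i
  proof -
    have s: "\<sigma> \<le> cmod (z - \<rho> i)"
      using far[OF root[OF that]] by (simp add: dist_norm)
    have "cmod (w - \<rho> i) \<le> 2 + cmod (z - \<rho> i)"
      using zw norm_triangle_ineq[of "w - z" "z - \<rho> i"] by (simp add: dist_norm)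
    then have "cmod (w - \<rho> i) * \<sigma> \<le> (2 + cmod (z - \<rho> i)) * \<sigma>"
      using \<sigma> by simp
    also have "\<dots> \<le> cmod (z - \<rho> i) * (2 + \<sigma>)"
      using s by (simp add: algebra_simps)
    finally show ?thesis
      using \<sigma> by (simp add: r_def field_simps)
  qed
  have "cmod (poly p w) * r ^ degree p
      = cmod (lead_coeff p) * (\<Prod>i<degree p. cmod (w - \<rho> i) * r)"
    by (simp add: ev norm_mult prod.distrib flip: prod_norm)
  also have "\<dots> \<le> cmod (lead_coeff p) * (\<Prod>i<degree p. cmod (z - \<rho> i))"
    using factor \<sigma> by (intro mult_left_mono prod_mono) (auto simp: r_def)
  also have "\<dots> = cmod (poly p z)"
    by (simp add: ev norm_mult flip: prod_norm)
  finally show ?thesis by (simp add: r_def)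
qed simp

text \<open>
  A point of \<open>Z\<close> at which \<open>g\<close> is so small lies within \<open>\<sigma>\<close> of one of the at most \<open>2d\<close> roots of the
  polynomial that represents \<open>g\<close>. This is a discrete substitute for Remez' inequality.
\<close>

lemma card_small_values_le:
  assumes g: "laurent_on_circle d g"
    and w: "w \<in> sphere 0 1" "\<delta> \<le> cmod (g w)" and \<delta>: "\<delta> > 0"
    and Z: "Z \<subseteq> sphere 0 1" and \<sigma>: "\<sigma> > 0"
    and sep: "\<And>x y. x \<in> Z \<Longrightarrow> y \<in> Z \<Longrightarrow> x \<noteq> y \<Longrightarrow> 2 * \<sigma> \<le> dist x y"
  shows "card {z \<in> Z. cmod (g z) < \<delta> * (\<sigma> / (2 + \<sigma>)) ^ (2 * d)} \<le> 2 * d"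
proof -
  define r where "r = \<sigma> / (2 + \<sigma>)"
  have r: "0 < r" "r \<le> 1" using \<sigma> by (auto simp: r_def)
  obtain p where p: "degree p \<le> 2 * d" "\<And>z. z \<in> sphere 0 1 \<Longrightarrow> z ^ d * g z = poly p z"
    using g unfolding laurent_on_circle_def by blast
  have modulus: "cmod (g z) = cmod (poly p z)" if "z \<in> sphere 0 1" for z
    using that by (simp flip: p(2) add: norm_mult norm_power)
  have "p \<noteq> 0" using modulus[OF w(1)] w(2) \<delta> by auto
  define bad where "bad = {z \<in> Z. cmod (g z) < \<delta> * r ^ (2 * d)}"
  have "\<exists>x. poly p x = 0 \<and> dist z x < \<sigma>" if "z \<in> bad" for z
  proof (rule ccontr)
    assume "\<not> ?thesis"
    then have far: "\<And>x. poly p x = 0 \<Longrightarrow> dist z x \<ge> \<sigma>" by force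
    have z: "z \<in> sphere 0 1" using that Z by (auto simp: bad_def)
    have "dist w z \<le> 2"
      using norm_triangle_ineq4[of w z] w(1) z by (simp add: dist_norm)
    then have "cmod (g w) * r ^ degree p \<le> cmod (g z)"
      using poly_lower_bound_off_roots[OF \<sigma> _ far] modulus w(1) z by (simp add: r_def)
    moreover have "\<delta> * r ^ (2 * d) \<le> cmod (g w) * r ^ degree p"
      using w(2) p(1) r \<delta> by (intro mult_mono power_decreasing) auto
    ultimately show False using that by (simp add: bad_def)
  qed
  then obtain root where root: "\<And>z. z \<in> bad \<Longrightarrow> poly p (root z) = 0 \<and> dist z (root z) < \<sigma>"
    by metis
  \<comment> \<open>two points of \<open>Z\<close> are too far apart to share a root\<close>
  have inj: "inj_on root bad"
  proof (rule inj_onI, rule ccontr)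
    fix x y assume xy: "x \<in> bad" "y \<in> bad" "root x = root y" "x \<noteq> y"
    have "dist x y \<le> dist x (root x) + dist y (root x)"
      by (rule dist_triangle2)
    also have "\<dots> < 2 * \<sigma>" using root[OF xy(1)] root[OF xy(2)] xy(3) by simp
    finally show False using sep[of x y] xy by (simp add: bad_def)
  qed
  have "card bad \<le> card {x. poly p x = 0}"
    using root poly_roots_finite[OF \<open>p \<noteq> 0\<close>] by (intro card_inj_on_le[OF inj]) auto
  also have "\<dots> \<le> 2 * d"
    using card_poly_roots_bound[OF \<open>p \<noteq> 0\<close>] p(1) by linarith
  finally show ?thesis by (simp add: bad_def r_def)
qed

text \<open>
  Induction on the number of variables. Let all variables but the first be as at the point where \<open>g\<close>
  is large. For all but \<open>2d\<close> values \<open>x\<close> of the first one, the value loses at most a factor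
  \<open>(\<sigma>/(2+\<sigma>))\<^bsup>2d\<^esup>\<close>, and the induction hypothesis applies to the slice at \<open>x\<close>. The exceptional slices
  are counted in full.
\<close>

lemma card_small_values_multi_le:
  fixes g :: "complex list \<Rightarrow> complex"
  assumes \<delta>: "\<delta> > 0"
    and Z: "Z \<subseteq> sphere 0 1" "finite Z" and \<sigma>: "\<sigma> > 0"
    and sep: "\<And>x y. x \<in> Z \<Longrightarrow> y \<in> Z \<Longrightarrow> x \<noteq> y \<Longrightarrow> 2 * \<sigma> \<le> dist x y"
    and laurent: "\<And>k ws. k < m \<Longrightarrow> length ws = m \<Longrightarrow> set ws \<subseteq> sphere 0 1 \<Longrightarrow>
            laurent_on_circle d (\<lambda>z. g (ws[k := z]))"
    and large: "length ws = m" "set ws \<subseteq> sphere 0 1" "\<delta> \<le> cmod (g ws)"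
  shows "card Z * card {xs. set xs \<subseteq> Z \<and> length xs = m \<and>
             cmod (g xs) < \<delta> * (\<sigma> / (2 + \<sigma>)) ^ (2 * d * m)} \<le> 2 * d * m * card Z ^ m"
  using laurent large \<delta>
proof (induction m arbitrary: g \<delta> ws)
  case 0
  then have "{xs. set xs \<subseteq> Z \<and> length xs = 0 \<and> cmod (g xs) < \<delta> * (\<sigma> / (2 + \<sigma>)) ^ (2 * d * 0)} = {}"
    by auto
  then show ?case by (simp only: card.empty)
next
  case (Suc m)
  define r where "r = \<sigma> / (2 + \<sigma>)"
  have r: "r > 0" using \<sigma> by (simp add: r_def)
  obtain w us where ws: "ws = w # us" using Suc.prems(2) by (cases ws) auto
  define \<delta>' where "\<delta>' = \<delta> * r ^ (2 * d)"
  have \<delta>': "\<delta>' > 0" using Suc.prems r by (simp add: \<delta>'_def)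
  define N where "N = card Z"
  define bad where "bad = {z \<in> Z. cmod (g (z # us)) < \<delta>'}"
  define slice where "slice x = {xs. set xs \<subseteq> Z \<and> length xs = m \<and>
      cmod (g (x # xs)) < \<delta>' * r ^ (2 * d * m)}" for x
  have fin_slice: "finite (slice x)" for x
    unfolding slice_def by (rule finite_subset[OF _ finite_lists_length_eq[OF Z(2), of m]]) auto
  have slice_le: "card (slice x) \<le> N ^ m" for x
    unfolding slice_def N_def card_lists_length_eq[OF Z(2), symmetric]
    by (rule card_mono) (use finite_lists_length_eq[OF Z(2), of m] in auto)
  have "laurent_on_circle d (\<lambda>z. g (z # us))"
    using Suc.prems(1)[of 0 ws] Suc.prems by (simp add: ws)
  then have bad_le: "card bad \<le> 2 * d"
    unfolding bad_def \<delta>'_def r_def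
    using Suc.prems(3-5) by (intro card_small_values_le[where w = w]) (auto simp: ws Z(1) \<sigma> sep)
  have good_le: "N * card (slice x) \<le> 2 * d * m * N ^ m" if "x \<in> Z - bad" for x
    unfolding slice_def N_def r_def
  proof (rule Suc.IH[of "\<lambda>xs. g (x # xs)" us])
    fix k and vs :: "complex list" assume "k < m" "length vs = m" "set vs \<subseteq> sphere 0 (1::real)"
    then show "laurent_on_circle d (\<lambda>z. g (x # vs[k := z]))"
      using Suc.prems(1)[of "Suc k" "x # vs"] that Z(1) by auto
  qed (use Suc.prems ws that \<delta>' in \<open>auto simp: bad_def\<close>)
  let ?B = "{xs. set xs \<subseteq> Z \<and> length xs = Suc m \<and> cmod (g xs) < \<delta> * r ^ (2 * d * Suc m)}"
  have "?B \<subseteq> (\<Union>x\<in>Z. (#) x ` slice x)"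
  proof
    fix xs assume xs: "xs \<in> ?B"
    then obtain x ys where x: "xs = x # ys" by (cases xs) auto
    have "\<delta> * r ^ (2 * d * Suc m) = \<delta>' * r ^ (2 * d * m)"
      by (simp add: \<delta>'_def power_add)
    with xs x have "x \<in> Z" "ys \<in> slice x"
      by (simp_all add: slice_def)
    with x show "xs \<in> (\<Union>x\<in>Z. (#) x ` slice x)" by blast
  qed
  then have "card ?B \<le> card (\<Union>x\<in>Z. (#) x ` slice x)"
    using Z(2) fin_slice by (intro card_mono) auto
  also have "\<dots> \<le> (\<Sum>x\<in>Z. card (slice x))"
    by (intro order_trans[OF card_UN_le[OF Z(2)] sum_mono] card_image_le fin_slice)
  finally have "N * card ?B \<le> (\<Sum>x\<in>Z. N * card (slice x))"
    unfolding sum_distrib_left[symmetric] by (rule mult_le_mono2)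
  also have "\<dots> = (\<Sum>x\<in>bad. N * card (slice x)) + (\<Sum>x\<in>Z - bad. N * card (slice x))"
    using Z(2) by (subst add.commute, intro sum.subset_diff) (auto simp: bad_def)
  also have "\<dots> \<le> (\<Sum>x\<in>bad. N ^ Suc m) + (\<Sum>x\<in>Z - bad. 2 * d * m * N ^ m)"
  proof (intro add_mono sum_mono)
    show "N * card (slice x) \<le> N ^ Suc m" for x
      using mult_le_mono2[OF slice_le] by simp
  qed (rule good_le)
  also have "\<dots> \<le> 2 * d * N ^ Suc m + N * (2 * d * m * N ^ m)"
  proof (rule add_mono)
    show "(\<Sum>x\<in>bad. N ^ Suc m) \<le> 2 * d * N ^ Suc m"
      unfolding sum_constant of_nat_id using bad_le by (rule mult_le_mono1)
    have "card (Z - bad) \<le> N" unfolding N_def by (intro card_mono Z(2)) auto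
    then show "(\<Sum>x\<in>Z - bad. 2 * d * m * N ^ m) \<le> N * (2 * d * m * N ^ m)"
      unfolding sum_constant of_nat_id by (rule mult_le_mono1)
  qed
  also have "\<dots> = 2 * d * Suc m * N ^ Suc m" by (simp add: algebra_simps)
  finally show ?case by (simp add: N_def r_def)
qed

text \<open>
  Points of an arc of a quarter circle with equally spaced real parts. They need not be spread over
  the whole circle, since the point where a function is large may lie anywhere on it.
\<close>

definition circle_net :: "nat \<Rightarrow> complex set" where
  "circle_net N = (\<lambda>k. Complex (real k / real N) (sqrt (1 - (real k / real N)\<^sup>2))) ` {..<N}"

lemma finite_circle_net: "finite (circle_net N)"
  by (simp add: circle_net_def)

lemma circle_net_sphere: "circle_net N \<subseteq> sphere 0 1"
proof
  fix z assume "z \<in> circle_net N"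
  then obtain k where k: "k < N" "z = Complex (real k / real N) (sqrt (1 - (real k / real N)\<^sup>2))"
    by (auto simp: circle_net_def)
  have "(real k / real N)\<^sup>2 \<le> 1"
    using k(1) by (intro power_le_one) auto
  then show "z \<in> sphere 0 1" by (simp add: k(2) cmod_def)
qed

lemma card_circle_net: "card (circle_net N) = N"
  unfolding circle_net_def by (subst card_image) (auto simp: inj_on_def)

lemma circle_net_separated:
  assumes "x \<in> circle_net N" "y \<in> circle_net N" "x \<noteq> y"
  shows "1 / real N \<le> dist x y"
proof -
  obtain k l where kl: "k < N" "l < N" "Re x = real k / real N" "Re y = real l / real N" "k \<noteq> l"
    using assms unfolding circle_net_def by fastforce
  have "1 \<le> \<bar>real k - real l\<bar>" using kl(5) by linarith
  then have "1 / real N \<le> \<bar>Re (x - y)\<bar>"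
    using kl by (simp add: divide_right_mono flip: diff_divide_distrib)
  also have "\<dots> \<le> dist x y"
    unfolding dist_norm by (rule abs_Re_le_cmod)
  finally show ?thesis .
qed

section \<open>Rotation matrices\<close>

definition rot_z :: "complex \<Rightarrow> real^3^3" where
  "rot_z w = vector [vector [Re w, - Im w, 0], vector [Im w, Re w, 0], vector [0, 0, 1]]"

definition rot_x :: "complex \<Rightarrow> real^3^3" where
  "rot_x w = vector [vector [1, 0, 0], vector [0, Re w, - Im w], vector [0, Im w, Re w]]"

lemma SO3_iff: "A \<in> SO3 \<longleftrightarrow> orthogonal_matrix A \<and> det A = 1"
  by (simp add: SO3_def rotation_matrix_def)

lemma SO3_mat_1 [simp]: "mat 1 \<in> SO3"
  by (simp add: SO3_iff orthogonal_matrix_id)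

lemma SO3_mult: "A \<in> SO3 \<Longrightarrow> B \<in> SO3 \<Longrightarrow> A ** B \<in> SO3"
  by (simp add: SO3_iff orthogonal_matrix_mul det_mul)

lemma SO3_transpose: "A \<in> SO3 \<Longrightarrow> transpose A \<in> SO3"
  by (simp add: SO3_iff det_transpose)

lemma SO3_transpose_inverse:
  assumes "A \<in> SO3"
  shows "A ** transpose A = mat 1" "transpose A ** A = mat 1"
  using assms by (simp_all add: SO3_iff orthogonal_matrix_def)

lemma matrix_inv_SO3:
  assumes "A \<in> SO3"
  shows "matrix_inv A = transpose A"
proof -
  have inv: "A ** matrix_inv A = mat 1"
    unfolding matrix_inv_def
    using someI[of "\<lambda>A'. A ** A' = mat 1 \<and> A' ** A = mat 1" "transpose A"]
      SO3_transpose_inverse[OF assms] by simp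
  have "matrix_inv A = (transpose A ** A) ** matrix_inv A"
    by (simp add: SO3_transpose_inverse[OF assms])
  also have "\<dots> = transpose A"
    by (simp add: inv flip: matrix_mul_assoc)
  finally show ?thesis .
qed

lemma rot_SO3:
  assumes "w \<in> sphere 0 1"
  shows "rot_z w \<in> SO3" "rot_x w \<in> SO3"
proof -
  have w: "Re w * Re w + Im w * Im w = 1"
    using assms by (simp add: cmod_def power2_eq_square)
  then have "Im w * Im w + Re w * Re w = 1" by simp
  with w show "rot_z w \<in> SO3" "rot_x w \<in> SO3"
    unfolding SO3_iff orthogonal_matrix rot_z_def rot_x_def
    by (simp_all add: vec_eq_iff forall_3 matrix_matrix_mult_def transpose_def sum_3 mat_def det_3)
qed


section \<open>Words as trigonometric polynomials\<close>

definition laurent_matrix :: "nat \<Rightarrow> (complex \<Rightarrow> real^3^3) \<Rightarrow> bool" where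
  "laurent_matrix d F \<longleftrightarrow> (\<forall>i j. laurent_on_circle d (\<lambda>z. of_real (F z $ i $ j)))"

lemma laurent_matrix_const: "laurent_matrix d (\<lambda>_. A)"
  by (simp add: laurent_matrix_def laurent_on_circle_const)

lemma laurent_matrix_transpose:
  "laurent_matrix d F \<Longrightarrow> laurent_matrix d (\<lambda>z. transpose (F z))"
  by (simp add: laurent_matrix_def transpose_def)

lemma laurent_matrix_mult:
  assumes "laurent_matrix d F" "laurent_matrix e G"
  shows "laurent_matrix (d + e) (\<lambda>z. F z ** G z)"
  unfolding laurent_matrix_def
proof (intro allI)
  fix i j
  have "laurent_on_circle (d + e)
      (\<lambda>z. \<Sum>k\<in>UNIV. of_real (F z $ i $ k) * of_real (G z $ k $ j))"
    using assms unfolding laurent_matrix_def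
    by (intro laurent_on_circle_sum laurent_on_circle_mult) auto
  then show "laurent_on_circle (d + e) (\<lambda>z. of_real ((F z ** G z) $ i $ j))"
    by (simp add: matrix_matrix_mult_def)
qed

lemma laurent_matrix_mult_const:
  assumes "laurent_matrix d F"
  shows "laurent_matrix d (\<lambda>z. F z ** A)" "laurent_matrix d (\<lambda>z. A ** F z)"
  using laurent_matrix_mult[OF assms laurent_matrix_const[of 0 A]]
    laurent_matrix_mult[OF laurent_matrix_const[of 0 A] assms] by simp_all

lemma laurent_matrix_rot: "laurent_matrix 1 rot_z" "laurent_matrix 1 rot_x"
proof -
  have "laurent_on_circle 1 (\<lambda>z. - of_real (Im z))"
    using laurent_on_circle_mult[OF laurent_on_circle_const[of 0 "-1"] laurent_on_circle_Im]
    by simp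
  note entries = this laurent_on_circle_Re laurent_on_circle_Im laurent_on_circle_const
  show "laurent_matrix 1 rot_z" "laurent_matrix 1 rot_x"
    unfolding laurent_matrix_def rot_z_def rot_x_def forall_3
    using entries by simp_all
qed

lemma mat_powi_SO3:
  assumes "A \<in> SO3"
  shows "mat_powi A k = ((**) (if 0 \<le> k then A else transpose A) ^^ nat \<bar>k\<bar>) (mat 1)"
  by (simp add: mat_powi_def matrix_inv_SO3[OF assms])

lemma laurent_matrix_funpow:
  assumes "laurent_matrix 1 F"
  shows "laurent_matrix n (\<lambda>z. ((**) (F z) ^^ n) (mat 1))"
proof (induction n)
  case (Suc n)
  show ?case using laurent_matrix_mult[OF assms Suc] by simp
qed (simp add: laurent_matrix_const)

lemma laurent_on_circle_cong:
  assumes "\<And>z. z \<in> sphere 0 1 \<Longrightarrow> g z = h z"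
  shows "laurent_on_circle d g \<longleftrightarrow> laurent_on_circle d h"
  using assms by (simp add: laurent_on_circle_def)

lemma laurent_matrix_cong:
  assumes "\<And>z. z \<in> sphere 0 1 \<Longrightarrow> F z = G z"
  shows "laurent_matrix d F \<longleftrightarrow> laurent_matrix d G"
  unfolding laurent_matrix_def using assms
  by (intro all_cong1 laurent_on_circle_cong) simp

lemma laurent_matrix_powi:
  assumes "laurent_matrix 1 F" "\<And>z. z \<in> sphere 0 1 \<Longrightarrow> F z \<in> SO3"
  shows "laurent_matrix (nat \<bar>k\<bar>) (\<lambda>z. mat_powi (F z) k)"
proof -
  have "laurent_matrix 1 (\<lambda>z. if 0 \<le> k then F z else transpose (F z))"
    using assms(1) laurent_matrix_transpose[OF assms(1)] by (cases "0 \<le> k") simp_all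
  from laurent_matrix_funpow[OF this, of "nat \<bar>k\<bar>"] show ?thesis
    by (subst laurent_matrix_cong[OF mat_powi_SO3[OF assms(2)]])
qed

lemma index_length_Nil [simp]: "index_length [] = 0"
  and index_length_Cons [simp]: "index_length ((s, r) # I) = \<bar>s\<bar> + \<bar>r\<bar> + index_length I"
  by (simp_all add: index_length_def)

lemma index_length_nonneg: "0 \<le> index_length I"
  by (induction I) (auto simp: index_length_def)

lemma laurent_matrix_word:
  assumes F: "laurent_matrix 1 F" "\<And>z. z \<in> sphere 0 1 \<Longrightarrow> F z \<in> SO3"
    and G: "laurent_matrix 1 G" "\<And>z. z \<in> sphere 0 1 \<Longrightarrow> G z \<in> SO3"
  shows "laurent_matrix (nat (index_length I)) (\<lambda>z. word I (F z) (G z))"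
proof (induction I)
  case (Cons sr I)
  obtain s r where sr: "sr = (s, r)" by force
  have "nat (index_length (sr # I)) = nat \<bar>s\<bar> + nat \<bar>r\<bar> + nat (index_length I)"
    using index_length_nonneg[of I] by (simp add: sr nat_add_distrib)
  then show ?case
    using laurent_matrix_mult[OF laurent_matrix_mult[OF laurent_matrix_powi[OF F, of s]
        laurent_matrix_powi[OF G, of r]] Cons.IH]
    by (simp add: sr)
qed (simp add: laurent_matrix_const)


section \<open>Euler angles\<close>

text \<open>
  Choose \<open>u\<close> and \<open>v\<close> such that \<open>rot_z u ** rot_x v\<close> moves the third axis to the same place as \<open>Q\<close>
  does. What is left is a rotation that fixes the third axis.
\<close>

lemma SO3_euler_angles:
  assumes "Q \<in> SO3"
  obtains u v w where "u \<in> sphere 0 1" "v \<in> sphere 0 1" "w \<in> sphere 0 1"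
    "Q = rot_z u ** rot_x v ** rot_z w"
proof -
  define a b c where "a = Q$1$3" "b = Q$2$3" "c = Q$3$3"
  have abc: "a\<^sup>2 + b\<^sup>2 + c\<^sup>2 = 1"
  proof -
    have "(transpose Q ** Q) $ 3 $ 3 = 1"
      using SO3_transpose_inverse(2)[OF assms] by (simp add: mat_def)
    then show ?thesis
      by (simp add: matrix_matrix_mult_def transpose_def sum_3 power2_eq_square a_b_c_def)
  qed
  define \<rho> where "\<rho> = sqrt (a\<^sup>2 + b\<^sup>2)"
  have \<rho>2: "\<rho>\<^sup>2 = a\<^sup>2 + b\<^sup>2" by (simp add: \<rho>_def)
  \<comment> \<open>if \<open>\<rho> = 0\<close>, then \<open>Q\<close> maps the third axis to itself or its opposite, and any \<open>u\<close> will do\<close>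
  define u where "u = (if \<rho> = 0 then 1 else Complex (- b / \<rho>) (a / \<rho>))"
  define v where "v = Complex c \<rho>"
  have u: "u \<in> sphere 0 1"
  proof (cases "\<rho> = 0")
    case False
    have "(b / \<rho>)\<^sup>2 + (a / \<rho>)\<^sup>2 = (a\<^sup>2 + b\<^sup>2) / \<rho>\<^sup>2"
      by (simp add: power_divide add_divide_distrib)
    also have "\<dots> = 1" using False by (simp flip: \<rho>2)
    finally show ?thesis using False by (simp add: u_def cmod_def)
  qed (simp add: u_def)
  have v: "v \<in> sphere 0 1"
    using abc \<rho>2 by (simp add: v_def cmod_def add_ac)
  have uv: "Im u * \<rho> = a" "- Re u * \<rho> = b"
    using \<rho>2 by (auto simp: u_def)
  define P where "P = rot_z u ** rot_x v"
  have P: "P \<in> SO3" unfolding P_def using u v by (intro SO3_mult rot_SO3)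
  have P3: "P$1$3 = a" "P$2$3 = b" "P$3$3 = c"
    using uv by (simp_all add: P_def rot_z_def rot_x_def matrix_matrix_mult_def sum_3 v_def)
  define M where "M = transpose P ** Q"
  have M: "M \<in> SO3" unfolding M_def by (intro SO3_mult SO3_transpose P assms)
  have QPM: "Q = P ** M"
    by (simp add: M_def matrix_mul_assoc SO3_transpose_inverse[OF P])
  \<comment> \<open>\<open>P\<close> and \<open>Q\<close> have the same last column, so \<open>M\<close> fixes the third axis\<close>
  have col: "M$i$3 = mat 1 $ i $ 3" for i
  proof -
    have "M$i$3 = (transpose P ** P) $ i $ 3"
      by (simp add: M_def matrix_matrix_mult_def sum_3 P3 a_b_c_def)
    then show ?thesis by (simp add: SO3_transpose_inverse[OF P])
  qed
  have M3: "M$1$3 = 0" "M$2$3 = 0" "M$3$3 = 1"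
    by (simp_all add: col mat_def)
  have orth: "(transpose M ** M) $ i $ j = mat 1 $ i $ j" for i j
    by (simp add: SO3_transpose_inverse[OF M])
  have row: "M$3$1 = 0" "M$3$2 = 0"
    using orth[of 1 3] orth[of 2 3]
    by (simp_all add: matrix_matrix_mult_def transpose_def sum_3 M3 mat_def)
  have unit: "(M$1$1)\<^sup>2 + (M$2$1)\<^sup>2 = 1" "(M$1$2)\<^sup>2 + (M$2$2)\<^sup>2 = 1"
    using orth[of 1 1] orth[of 2 2]
    by (simp_all add: matrix_matrix_mult_def transpose_def sum_3 row mat_def power2_eq_square)
  have det: "M$1$1 * M$2$2 - M$1$2 * M$2$1 = 1"
    using M by (simp add: SO3_iff det_3 M3 row)
  \<comment> \<open>the sum of the squared lengths of the two columns minus twice their determinant\<close>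
  have "(M$1$1 - M$2$2)\<^sup>2 + (M$1$2 + M$2$1)\<^sup>2 = 0"
    using unit det by (simp add: power2_eq_square algebra_simps)
  then have block: "M$2$2 = M$1$1" "M$1$2 = - M$2$1"
    by (auto simp: sum_power2_eq_zero_iff)
  define w where "w = Complex (M$1$1) (M$2$1)"
  have "M = rot_z w"
    by (simp add: vec_eq_iff forall_3 rot_z_def w_def M3 row block)
  moreover have "w \<in> sphere 0 1" using unit by (simp add: w_def cmod_def)
  ultimately show ?thesis using that u v QPM unfolding P_def by blast
qed

definition euler :: "complex \<Rightarrow> complex \<Rightarrow> complex \<Rightarrow> real^3^3" where
  "euler u v w = rot_z u ** rot_x v ** rot_z w"

lemma euler_SO3:
  "u \<in> sphere 0 1 \<Longrightarrow> v \<in> sphere 0 1 \<Longrightarrow> w \<in> sphere 0 1 \<Longrightarrow> euler u v w \<in> SO3"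
  unfolding euler_def by (intro SO3_mult rot_SO3)

lemma laurent_matrix_euler:
  "laurent_matrix 1 (\<lambda>z. euler z v w)"
  "laurent_matrix 1 (\<lambda>z. euler u z w)"
  "laurent_matrix 1 (\<lambda>z. euler u v z)"
  unfolding euler_def by (intro laurent_matrix_mult_const laurent_matrix_rot)+

lemma euler_transitive:
  assumes "A \<in> SO3" "B \<in> SO3"
  obtains u v w where "u \<in> sphere 0 1" "v \<in> sphere 0 1" "w \<in> sphere 0 1" "euler u v w ** A = B"
proof -
  have "B ** transpose A \<in> SO3" using assms by (intro SO3_mult SO3_transpose)
  then obtain u v w where uvw: "u \<in> sphere 0 1" "v \<in> sphere 0 1" "w \<in> sphere 0 1"
    and "B ** transpose A = euler u v w"
    using SO3_euler_angles unfolding euler_def by metis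
  then have "euler u v w ** A = B ** (transpose A ** A)" by (simp add: matrix_mul_assoc)
  then show ?thesis using that uvw SO3_transpose_inverse[OF assms(1)] by simp
qed

definition move_pair :: "complex list \<Rightarrow> (real^3^3) \<times> (real^3^3) \<Rightarrow> (real^3^3) \<times> (real^3^3)" where
  "move_pair xs = (\<lambda>(A, B). (euler (xs!0) (xs!1) (xs!2) ** A, euler (xs!3) (xs!4) (xs!5) ** B))"

text \<open>
  The entry of the word, as a function of the six angles, is a trigonometric polynomial of degree at
  most \<open>n\<close> in each of them. By transitivity some angles lead to \<open>(A', B')\<close>, where it is at least \<open>\<delta>\<close>,
  so the multivariate count applies; the exponent is \<open>2 n \<sqdot> 6\<close>, and \<open>\<sigma> = 1/(2N)\<close>.
\<close>

lemma card_translates_small_entry_le: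
  fixes A B C A' B' :: "real^3^3" and i j :: 3 and I :: "(int \<times> int) list"
  defines "f \<equiv> \<lambda>(A, B). word I A B $ i $ j - C $ i $ j"
  assumes AB: "A \<in> SO3" "B \<in> SO3" and AB': "A' \<in> SO3" "B' \<in> SO3"
    and \<delta>: "0 < \<delta>" "\<delta> \<le> \<bar>f (A', B')\<bar>"
    and n: "index_length I = int n" and N: "N > 0"
  shows "N * card {xs. set xs \<subseteq> circle_net N \<and> length xs = 6 \<and>
           \<bar>f (move_pair xs (A, B))\<bar> < \<delta> * (1 / (4 * real N + 1)) ^ (12 * n)} \<le> 12 * n * N ^ 6"
proof -
  define g where "g xs = complex_of_real (f (move_pair xs (A, B)))" for xs
  define \<sigma> where "\<sigma> = 1 / (2 * real N)"
  have \<sigma>: "\<sigma> > 0" "\<sigma> / (2 + \<sigma>) = 1 / (4 * real N + 1)"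
    using N by (auto simp: \<sigma>_def field_simps)
  have sep: "2 * \<sigma> \<le> dist x y" if "x \<in> circle_net N" "y \<in> circle_net N" "x \<noteq> y" for x y
    using circle_net_separated[OF that] by (simp add: \<sigma>_def)
  obtain u v w where uvw: "u \<in> sphere 0 1" "v \<in> sphere 0 1" "w \<in> sphere 0 1" "euler u v w ** A = A'"
    using euler_transitive AB AB' by metis
  obtain x y z where xyz: "x \<in> sphere 0 1" "y \<in> sphere 0 1" "z \<in> sphere 0 1" "euler x y z ** B = B'"
    using euler_transitive AB AB' by metis
  have large: "\<delta> \<le> cmod (g [u, v, w, x, y, z])"
    using \<delta>(2) uvw(4) xyz(4) by (simp add: g_def move_pair_def eval_nat_numeral)
  have laurent: "laurent_on_circle n (\<lambda>t. g (ws[k := t]))"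
    if k: "k < 6" and ws: "length ws = 6" "set ws \<subseteq> sphere 0 1" for k ws
  proof -
    define F where "F t = euler (ws[k := t]!0) (ws[k := t]!1) (ws[k := t]!2) ** A" for t
    define G where "G t = euler (ws[k := t]!3) (ws[k := t]!4) (ws[k := t]!5) ** B" for t
    have on_sphere: "ws[k := t]!l \<in> sphere 0 1" if "t \<in> sphere 0 1" "l < 6" for t l
    proof -
      have "set (ws[k := t]) \<subseteq> sphere 0 1"
        using set_update_subset_insert[of ws k t] ws(2) that(1) by blast
      moreover have "ws[k := t]!l \<in> set (ws[k := t])"
        using that(2) ws(1) by (intro nth_mem) simp
      ultimately show ?thesis by blast
    qed
    have SO3: "F t \<in> SO3" "G t \<in> SO3" if "t \<in> sphere 0 1" for t
      unfolding F_def G_def using that AB on_sphere by (auto intro!: SO3_mult euler_SO3)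
    have FG: "F = (\<lambda>t. euler (ws[k := t]!0) (ws[k := t]!1) (ws[k := t]!2) ** A)"
      "G = (\<lambda>t. euler (ws[k := t]!3) (ws[k := t]!4) (ws[k := t]!5) ** B)"
      by (simp_all add: F_def G_def fun_eq_iff)
    have "k = 0 \<or> k = 1 \<or> k = 2 \<or> k = 3 \<or> k = 4 \<or> k = 5" using k by linarith
    then have "laurent_matrix 1 F \<and> laurent_matrix 1 G"
      unfolding FG using ws(1)
      by (elim disjE) (simp_all add: laurent_matrix_const laurent_matrix_mult_const(1)[OF laurent_matrix_euler(1)]
        laurent_matrix_mult_const(1)[OF laurent_matrix_euler(2)]
        laurent_matrix_mult_const(1)[OF laurent_matrix_euler(3)] del: One_nat_def)
    then have "laurent_matrix n (\<lambda>t. word I (F t) (G t))"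
      using laurent_matrix_word[of F G I] SO3 n by simp
    then have "laurent_on_circle n (\<lambda>t. of_real (word I (F t) (G t) $ i $ j) + of_real (- C $ i $ j))"
      unfolding laurent_matrix_def by (intro laurent_on_circle_add laurent_on_circle_const) auto
    then show ?thesis
      by (simp add: g_def f_def move_pair_def F_def G_def)
  qed
  have "card (circle_net N) * card {xs. set xs \<subseteq> circle_net N \<and> length xs = 6 \<and>
      cmod (g xs) < \<delta> * (\<sigma> / (2 + \<sigma>)) ^ (2 * n * 6)} \<le> 2 * n * 6 * card (circle_net N) ^ 6"
    using uvw(1-3) xyz(1-3)
    by (intro card_small_values_multi_le[OF \<delta>(1) circle_net_sphere finite_circle_net \<sigma>(1) sep laurent _ _ large])
       simp_all
  moreover have "2 * n * 6 = 12 * n" by simp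
  moreover have "cmod (g xs) = \<bar>f (move_pair xs (A, B))\<bar>" for xs
    by (simp only: g_def norm_of_real)
  ultimately show ?thesis by (simp only: \<sigma>(2) card_circle_net)
qed

section \<open>A free pair of rotations, and words far from a given rotation\<close>

text \<open>
  The rotations by the angle with cosine \<open>3/5\<close> and sine \<open>4/5\<close>, about the third and the first axis,
  generate a free group. To see this, apply a word to the third unit vector, scale each letter by \<open>5\<close>
  and calculate modulo \<open>5\<close>: there each scaled letter has rank one,
  and its image lies in the kernel of a letter only if the two are inverse to each other. Hence a
  vector in the image of a letter is never annihilated by the next letter of a reduced word.
\<close>

definition int_vec :: "int \<times> int \<times> int \<Rightarrow> real^3" where
  "int_vec = (\<lambda>(x, y, z). vector [of_int x, of_int y, of_int z])"

definition step_z :: "int \<Rightarrow> int \<times> int \<times> int \<Rightarrow> int \<times> int \<times> int" where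
  "step_z e = (\<lambda>(x, y, z). (3 * x - 4 * e * y, 4 * e * x + 3 * y, 5 * z))"

definition step_x :: "int \<Rightarrow> int \<times> int \<times> int \<Rightarrow> int \<times> int \<times> int" where
  "step_x e = (\<lambda>(x, y, z). (5 * x, 3 * y - 4 * e * z, 4 * e * y + 3 * z))"

text \<open>
  The following predicates describe vectors modulo \<open>5\<close>. A vector is \<open>ready\<close> for rotations about an
  axis if neither the scaled rotation about this axis nor its inverse annihilates it. After a scaled
  rotation it lies in the image of that rotation and is nonzero. The sign \<open>e\<close> tells a rotation from
  its inverse.
\<close>

definition ready_z :: "int \<times> int \<times> int \<Rightarrow> bool" where
  "ready_z = (\<lambda>(x, y, z). \<forall>e\<in>{1, -1}. \<not> 5 dvd 3 * x - 4 * e * y)"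

definition ready_x :: "int \<times> int \<times> int \<Rightarrow> bool" where
  "ready_x = (\<lambda>(x, y, z). \<forall>e\<in>{1, -1}. \<not> 5 dvd 3 * y - 4 * e * z)"

definition after_z :: "int \<Rightarrow> int \<times> int \<times> int \<Rightarrow> bool" where
  "after_z e = (\<lambda>(x, y, z). \<not> 5 dvd x \<and> 5 dvd y - 3 * e * x \<and> 5 dvd z)"

definition after_x :: "int \<Rightarrow> int \<times> int \<times> int \<Rightarrow> bool" where
  "after_x e = (\<lambda>(x, y, z). \<not> 5 dvd y \<and> 5 dvd z - 3 * e * y \<and> 5 dvd x)"

lemma after_z_step:
  assumes "e \<in> {1, -1}" "after_z e v \<or> ready_z v"
  shows "after_z e (step_z e v)"
  using assms by (cases v) (auto simp: after_z_def ready_z_def step_z_def; presburger)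

lemma after_x_step:
  assumes "e \<in> {1, -1}" "after_x e v \<or> ready_x v"
  shows "after_x e (step_x e v)"
  using assms by (cases v) (auto simp: after_x_def ready_x_def step_x_def; presburger)

lemma ready_after: 
  assumes "e \<in> {1, -1}"
  shows "after_z e v \<Longrightarrow> ready_x v" "after_x e v \<Longrightarrow> ready_z v"
  using assms by (cases v; auto simp: after_z_def ready_z_def after_x_def ready_x_def; presburger)+

lemma after_z_funpow:
  assumes "e \<in> {1, -1}" "ready_z v" "0 < n"
  shows "after_z e ((step_z e ^^ n) v)"
  using assms(3)
proof (induction n)
  case (Suc n)
  then show ?case using after_z_step[OF assms(1)] assms(2) by (cases n) auto
qed simp

lemma after_x_funpow:
  assumes "e \<in> {1, -1}" "ready_x v" "0 < n"
  shows "after_x e ((step_x e ^^ n) v)"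
  using assms(3)
proof (induction n)
  case (Suc n)
  then show ?case using after_x_step[OF assms(1)] assms(2) by (cases n) auto
qed simp

fun int_word :: "(int \<times> int) list \<Rightarrow> int \<times> int \<times> int" where
  "int_word [] = (0, 0, 1)"
| "int_word ((s, r) # I) =
     (step_z (sgn s) ^^ nat \<bar>s\<bar>) ((step_x (sgn r) ^^ nat \<bar>r\<bar>) (int_word I))"

lemma int_word_not_dvd:
  assumes "multi_index I"
  shows "\<exists>e\<in>{1, -1}. after_z e (int_word I)"
proof -
  have "\<forall>(s, r)\<in>set I. s \<noteq> 0 \<and> r \<noteq> 0 \<Longrightarrow> I \<noteq> [] \<Longrightarrow> \<exists>e\<in>{1, -1}. after_z e (int_word I)" for I
  proof (induction I)
    case (Cons sr I)
    obtain s r where sr: "sr = (s, r)" by force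
    have sgn: "sgn s \<in> {1, -1}" "sgn r \<in> {1, -1}" and pos: "0 < nat \<bar>s\<bar>" "0 < nat \<bar>r\<bar>"
      using Cons.prems by (auto simp: sr sgn_if)
    have "ready_x (int_word I)"
    proof (cases "I = []")
      case False
      moreover have "\<forall>(s, r)\<in>set I. s \<noteq> 0 \<and> r \<noteq> 0" using Cons.prems(1) by simp
      ultimately obtain e where "e \<in> {1, -1}" "after_z e (int_word I)"
        using Cons.IH by blast
      then show ?thesis by (rule ready_after(1))
    qed (auto simp: ready_x_def)
    then have "after_x (sgn r) ((step_x (sgn r) ^^ nat \<bar>r\<bar>) (int_word I))"
      by (rule after_x_funpow[OF sgn(2) _ pos(2)])
    then have "after_z (sgn s) (int_word (sr # I))"
      using after_z_funpow[OF sgn(1) _ pos(1)] ready_after(2)[OF sgn(2)] by (simp add: sr)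
    then show ?case using sgn(1) by blast
  qed simp
  then show ?thesis using assms by (simp add: multi_index_def)
qed

definition unit_345 :: complex where
  "unit_345 = Complex (3/5) (4/5)"

lemma unit_345_sphere: "unit_345 \<in> sphere 0 1"
  by (simp add: unit_345_def cmod_def power2_eq_square)

lemma five_rot_345:
  "5 *\<^sub>R (rot_z unit_345 *v int_vec v) = int_vec (step_z 1 v)"
  "5 *\<^sub>R (transpose (rot_z unit_345) *v int_vec v) = int_vec (step_z (-1) v)"
  "5 *\<^sub>R (rot_x unit_345 *v int_vec v) = int_vec (step_x 1 v)"
  "5 *\<^sub>R (transpose (rot_x unit_345) *v int_vec v) = int_vec (step_x (-1) v)"
  by (cases v; simp add: vec_eq_iff forall_3 matrix_vector_mult_def transpose_def sum_3
      int_vec_def step_z_def step_x_def rot_z_def rot_x_def unit_345_def algebra_simps)+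

lemma scaled_funpow:
  fixes T :: "real^3^3" and f :: "int \<times> int \<times> int \<Rightarrow> int \<times> int \<times> int"
  assumes "\<And>v. 5 *\<^sub>R (T *v int_vec v) = int_vec (f v)"
  shows "5 ^ n *\<^sub>R (((**) T ^^ n) (mat 1) *v int_vec v) = int_vec ((f ^^ n) v)"
proof (induction n)
  case (Suc n)
  have "5 ^ Suc n *\<^sub>R (((**) T ^^ Suc n) (mat 1) *v int_vec v)
      = 5 *\<^sub>R (T *v (5 ^ n *\<^sub>R (((**) T ^^ n) (mat 1) *v int_vec v)))"
    by (simp add: matrix_vector_mul_assoc matrix_vector_mult_scaleR)
  then show ?case by (simp add: Suc assms)
qed simp

lemma scaled_powi:
  fixes f :: "int \<Rightarrow> int \<times> int \<times> int \<Rightarrow> int \<times> int \<times> int"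
  assumes "T \<in> SO3"
    and "\<And>v. 5 *\<^sub>R (T *v int_vec v) = int_vec (f 1 v)"
    and "\<And>v. 5 *\<^sub>R (transpose T *v int_vec v) = int_vec (f (-1) v)"
  shows "5 ^ nat \<bar>s\<bar> *\<^sub>R (mat_powi T s *v int_vec v) = int_vec ((f (sgn s) ^^ nat \<bar>s\<bar>) v)"
proof (cases s "0::int" rule: linorder_cases)
  case less
  then show ?thesis
    by (simp add: mat_powi_SO3[OF assms(1)] scaled_funpow[of _ "f (-1)", OF assms(3)] sgn_if)
next
  case greater
  then show ?thesis
    by (simp add: mat_powi_SO3[OF assms(1)] scaled_funpow[of _ "f 1", OF assms(2)] sgn_if)
qed (simp add: mat_powi_def)

text \<open>
  Each letter contributes one factor \<open>5\<close>, so the length of the word is the exponent of the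
  denominator.
\<close>

lemma scaled_word:
  "5 ^ nat (index_length I) *\<^sub>R (word I (rot_z unit_345) (rot_x unit_345) *v int_vec (0, 0, 1))
     = int_vec (int_word I)"
proof (induction I)
  case (Cons sr I)
  obtain s r where sr: "sr = (s, r)" by force
  let ?A = "mat_powi (rot_z unit_345) s" and ?B = "mat_powi (rot_x unit_345) r"
  let ?w = "word I (rot_z unit_345) (rot_x unit_345) *v int_vec (0, 0, 1)"
  have len: "nat (index_length (sr # I)) = nat \<bar>s\<bar> + nat \<bar>r\<bar> + nat (index_length I)"
    using index_length_nonneg[of I] by (simp add: sr nat_add_distrib)
  have "5 ^ nat (index_length (sr # I)) *\<^sub>R ((?A ** ?B ** word I (rot_z unit_345) (rot_x unit_345)) *v int_vec (0, 0, 1))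
     = 5 ^ nat \<bar>s\<bar> *\<^sub>R (?A *v (5 ^ nat \<bar>r\<bar> *\<^sub>R (?B *v (5 ^ nat (index_length I) *\<^sub>R ?w))))"
    unfolding len by (simp add: power_add matrix_vector_mult_scaleR flip: matrix_vector_mul_assoc)
  also have "\<dots> = int_vec (int_word (sr # I))"
    by (simp add: Cons sr scaled_powi[of _ step_x, OF rot_SO3(2)[OF unit_345_sphere] five_rot_345(3,4)]
        scaled_powi[of _ step_z, OF rot_SO3(1)[OF unit_345_sphere] five_rot_345(1,2)])
  finally show ?case by (simp add: sr)
qed simp

text \<open>
  The entry in the first row and third column is an integer over \<open>5\<^sup>n\<close>, and this integer is prime to
  \<open>5\<close>, hence not zero, because the word begins with a rotation about the third axis. The identity
  has the entry \<open>0\<close> there.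
\<close>

lemma word_345_far_from_identity:
  assumes "multi_index I" "index_length I = int n"
  shows "(1/5) ^ n \<le> \<bar>word I (rot_z unit_345) (rot_x unit_345) $ 1 $ 3 - (mat 1 :: real^3^3) $ 1 $ 3\<bar>"
proof -
  obtain x y z where xyz: "int_word I = (x, y, z)" by (cases "int_word I")
  then have "x \<noteq> 0"
    using int_word_not_dvd[OF assms(1)] by (auto simp: after_z_def)
  have "5 ^ n * word I (rot_z unit_345) (rot_x unit_345) $ 1 $ 3 = of_int x"
    using arg_cong[OF scaled_word[of I], of "\<lambda>v. v $ 1"]
    by (simp add: assms(2) xyz int_vec_def matrix_vector_mult_def sum_3)
  then have "5 ^ n * \<bar>word I (rot_z unit_345) (rot_x unit_345) $ 1 $ 3\<bar> = of_int \<bar>x\<bar>"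
    by (metis abs_mult abs_numeral of_int_abs power_abs)
  also have "\<dots> \<ge> 1" using \<open>x \<noteq> 0\<close> by linarith
  finally show ?thesis
    by (simp add: mat_def power_divide field_simps)
qed

lemma word_mat_1: "word I (mat 1) (mat 1) = mat 1"
proof (induction I)
  case (Cons sr I)
  have "mat_powi (mat 1) k = mat 1" for k
  proof -
    have "((**) (mat 1 :: real^3^3) ^^ n) (mat 1) = mat 1" for n
      by (induction n) auto
    then show ?thesis by (simp add: mat_powi_SO3 transpose_mat)
  qed
  then show ?case using Cons by (cases sr) simp
qed simp

lemma word_far_from_target:
  obtains \<delta> where "0 < \<delta>" "\<delta> \<le> 1"
    "\<And>I n. multi_index I \<Longrightarrow> index_length I = int n \<Longrightarrow> n \<ge> 1 \<Longrightarrow>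
       \<exists>A\<in>SO3. \<exists>B\<in>SO3. \<exists>i j. \<delta> ^ n \<le> \<bar>word I A B $ i $ j - C $ i $ j\<bar>"
proof (cases "C = mat 1")
  case True
  show ?thesis
  proof (rule that[of "1/5"])
    fix I n assume "multi_index I" "index_length I = int n"
    from word_345_far_from_identity[OF this]
    show "\<exists>A\<in>SO3. \<exists>B\<in>SO3. \<exists>i j. (1/5) ^ n \<le> \<bar>word I A B $ i $ j - C $ i $ j\<bar>"
      using True rot_SO3[OF unit_345_sphere] by blast
  qed auto
next
  case False
  then obtain i j where ij: "C $ i $ j \<noteq> mat 1 $ i $ j" by (auto simp: vec_eq_iff)
  define \<delta> where "\<delta> = min 1 \<bar>mat 1 $ i $ j - C $ i $ j\<bar>"
  show ?thesis
  proof (rule that[of \<delta>])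
    fix I :: "(int \<times> int) list" and n :: nat assume "n \<ge> 1"
    have "\<delta> ^ n \<le> \<delta> ^ 1"
      using ij \<open>n \<ge> 1\<close> by (intro power_decreasing) (auto simp: \<delta>_def)
    also have "\<dots> \<le> \<bar>word I (mat 1) (mat 1) $ i $ j - C $ i $ j\<bar>"
      by (simp add: \<delta>_def word_mat_1)
    finally show "\<exists>A\<in>SO3. \<exists>B\<in>SO3. \<exists>i j. \<delta> ^ n \<le> \<bar>word I A B $ i $ j - C $ i $ j\<bar>"
      using SO3_mat_1 by blast
  qed (use ij in \<open>auto simp: \<delta>_def\<close>)
qed

section \<open>Norms on matrices\<close>

text \<open>
  A norm is convex, hence continuous, and so attains a positive minimum on the Euclidean unit sphere.
\<close>

lemma norm_on_matrices_dominates_entries: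
  assumes N: "norm_on_matrices N"
  obtains \<kappa> where "0 < \<kappa>" "\<kappa> \<le> 1" "\<And>X i j. \<kappa> * \<bar>X $ i $ j\<bar> \<le> N X"
proof -
  have scale: "N (c *\<^sub>R X) = \<bar>c\<bar> * N X" and triangle: "N (X + Y) \<le> N X + N Y"
    and nonneg: "0 \<le> N X" and zero: "N X = 0 \<longleftrightarrow> X = 0" for c X Y
    using N by (auto simp: norm_on_matrices_def)
  have "convex_on UNIV N"
  proof (rule convex_onI)
    fix t :: real and X Y :: "real^3^3" assume "0 < t" "t < 1"
    then show "N ((1 - t) *\<^sub>R X + t *\<^sub>R Y) \<le> (1 - t) * N X + t * N Y"
      using triangle[of "(1 - t) *\<^sub>R X" "t *\<^sub>R Y"] by (simp add: scale)
  qed simp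
  then have cont: "continuous_on (sphere 0 1) N"
    using convex_on_continuous[of UNIV N] continuous_on_subset by blast
  have "sphere 0 1 \<noteq> ({} :: (real^3^3) set)" by simp
  then obtain X0 where X0: "X0 \<in> sphere 0 1" "\<And>X. X \<in> sphere 0 1 \<Longrightarrow> N X0 \<le> N X"
    using continuous_attains_inf[OF compact_sphere _ cont] by blast
  have "0 < N X0"
    using nonneg[of X0] zero[of X0] X0(1) by fastforce
  show ?thesis
  proof (rule that[of "min 1 (N X0)"])
    fix X :: "real^3^3" and i j
    have entry: "\<bar>X $ i $ j\<bar> \<le> norm X"
      using Finite_Cartesian_Product.norm_nth_le[of "X $ i" j] Finite_Cartesian_Product.norm_nth_le[of X i] by simp
    have "N X0 * norm X \<le> N X"
    proof (cases "X = 0")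
      case False
      then have "N X0 \<le> N ((1 / norm X) *\<^sub>R X)" by (intro X0(2)) simp
      then show ?thesis using False by (simp only: scale) (simp add: field_simps)
    qed (simp add: nonneg)
    moreover have "min 1 (N X0) * \<bar>X $ i $ j\<bar> \<le> N X0 * norm X"
      using entry \<open>0 < N X0\<close> by (intro mult_mono) auto
    ultimately show "min 1 (N X0) * \<bar>X $ i $ j\<bar> \<le> N X" by linarith
  qed (use \<open>0 < N X0\<close> in auto)
qed


section \<open>The number of words\<close>

text \<open>
  A list of total length \<open>n + 1\<close> arises from one of total length \<open>n\<close> in one of three ways: by a new
  first element \<open>1\<close>, by a new first element \<open>-1\<close>, or by moving the first element away from \<open>0\<close> by one.
\<close>

lemma card_nonzero_int_lists:
  defines "S \<equiv> \<lambda>n. {xs :: int list. 0 \<notin> set xs \<and> (\<Sum>x\<leftarrow>xs. \<bar>x\<bar>) = int n}"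
  shows "finite (S n) \<and> card (S n) \<le> 3 ^ n"
proof (induction n)
  case 0
  have "S 0 = {[]}"
  proof -
    have "xs = []" if "xs \<in> S 0" for xs
    proof (cases xs)
      case (Cons x ys)
      moreover have "0 \<le> (\<Sum>x\<leftarrow>ys. \<bar>x\<bar>)" by (rule sum_list_nonneg) auto
      ultimately show ?thesis using that by (auto simp: S_def)
    qed
    then show ?thesis by (auto simp: S_def)
  qed
  then show ?case by simp
next
  case (Suc n)
  define grow :: "int list \<Rightarrow> int list"
    where "grow xs = (hd xs + sgn (hd xs)) # tl xs" for xs
  have "S (Suc n) \<subseteq> (#) 1 ` S n \<union> (#) (- 1) ` S n \<union> grow ` S n"
  proof
    fix xs assume xs: "xs \<in> S (Suc n)"
    then obtain x ys where x: "xs = x # ys" by (cases xs) (auto simp: S_def)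
    have x0: "x \<noteq> 0" "0 \<notin> set ys" and len: "\<bar>x\<bar> + (\<Sum>x\<leftarrow>ys. \<bar>x\<bar>) = int n + 1"
      using xs by (auto simp: S_def x)
    show "xs \<in> (#) 1 ` S n \<union> (#) (- 1) ` S n \<union> grow ` S n"
    proof (cases "\<bar>x\<bar> = 1")
      case True
      then have "ys \<in> S n" using x0 len by (simp add: S_def)
      then show ?thesis using True by (auto simp: x abs_if split: if_splits)
    next
      case False
      have "sgn (x - sgn x) = sgn x" "\<bar>x - sgn x\<bar> = \<bar>x\<bar> - 1" "x - sgn x \<noteq> 0"
        using False x0 by (auto simp: sgn_if abs_if)
      then have "(x - sgn x) # ys \<in> S n" "grow ((x - sgn x) # ys) = xs"
        using x0 len by (auto simp: S_def grow_def x)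
      then show ?thesis by force
    qed
  qed
  moreover have "finite ((#) 1 ` S n \<union> (#) (- 1) ` S n \<union> grow ` S n)"
    using Suc by simp
  moreover have "card ((#) 1 ` S n \<union> (#) (- 1) ` S n \<union> grow ` S n) \<le> 3 ^ Suc n"
  proof -
    have "card ((#) 1 ` S n \<union> (#) (- 1) ` S n \<union> grow ` S n)
        \<le> card ((#) 1 ` S n) + card ((#) (- 1) ` S n) + card (grow ` S n)"
      by (rule order_trans[OF card_Un_le add_right_mono[OF card_Un_le]])
    also have "\<dots> \<le> card (S n) + card (S n) + card (S n)"
      using Suc by (intro add_mono card_image_le) auto
    finally show ?thesis using Suc by simp
  qed
  ultimately show ?case by (meson card_mono finite_subset order_trans)
qed

lemma card_multi_index_le:
  "finite {I. multi_index I \<and> index_length I = int n} \<and>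
   card {I. multi_index I \<and> index_length I = int n} \<le> 3 ^ n"
proof -
  define flat :: "(int \<times> int) list \<Rightarrow> int list"
    where "flat I = concat (map (\<lambda>(s, r). [s, r]) I)" for I
  let ?W = "{I. multi_index I \<and> index_length I = int n}"
  let ?S = "{xs :: int list. 0 \<notin> set xs \<and> (\<Sum>x\<leftarrow>xs. \<bar>x\<bar>) = int n}"
  have "flat I = flat J \<Longrightarrow> I = J" for I J
    by (induction I arbitrary: J; case_tac J) (auto simp: flat_def)
  then have inj: "inj_on flat ?W" by (auto intro: inj_onI)
  have sum: "(\<Sum>x\<leftarrow>flat I. \<bar>x\<bar>) = index_length I" for I
    by (induction I) (auto simp: flat_def index_length_def)
  have "flat ` ?W \<subseteq> ?S"
    by (auto simp: sum) (auto simp: flat_def multi_index_def)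
  then show ?thesis
    using inj card_nonzero_int_lists[of n]
    by (meson card_inj_on_le inj_on_finite order_trans)
qed


section \<open>Invariant measures\<close>

text \<open>
  Count the pairs \<open>(k, x)\<close> with \<open>T k x \<in> E\<close> in two ways. Integrating over \<open>x\<close> first gives
  \<open>measure M E\<close> for each \<open>k\<close>; summing over \<open>k\<close> first gives at most \<open>c\<close> for each \<open>x\<close>.
\<close>

lemma measure_le_by_averaging:
  assumes total: "emeasure M (space M) = 1" and E: "E \<in> sets M" and K: "finite K"
    and meas: "\<And>k. k \<in> K \<Longrightarrow> T k \<in> measurable M M"
    and preserving: "\<And>k. k \<in> K \<Longrightarrow> distr M M (T k) = M"
    and hits: "\<And>x. x \<in> space M \<Longrightarrow> card {k \<in> K. T k x \<in> E} \<le> c"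
  shows "real (card K) * measure M E \<le> real c"
proof -
  interpret finite_measure M by standard (simp add: total)
  have "of_nat (card K) * emeasure M E = (\<Sum>k\<in>K. emeasure (distr M M (T k)) E)"
    using preserving by simp
  also have "\<dots> = (\<Sum>k\<in>K. \<integral>\<^sup>+x. indicator E (T k x) \<partial>M)"
  proof (rule sum.cong[OF refl])
    fix k assume "k \<in> K"
    have "emeasure (distr M M (T k)) E = (\<integral>\<^sup>+x. indicator E x \<partial>distr M M (T k))"
      using E by simp
    also have "\<dots> = (\<integral>\<^sup>+x. indicator E (T k x) \<partial>M)"
      using E meas[OF \<open>k \<in> K\<close>] by (intro nn_integral_distr) auto
    finally show "emeasure (distr M M (T k)) E = (\<integral>\<^sup>+x. indicator E (T k x) \<partial>M)" .
  qed
  also have "\<dots> = (\<integral>\<^sup>+x. (\<Sum>k\<in>K. indicator E (T k x)) \<partial>M)"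
    using measurable_compose[OF meas borel_measurable_indicator[OF E]]
    by (intro nn_integral_sum[symmetric])
  also have "\<dots> \<le> (\<integral>\<^sup>+x. of_nat c \<partial>M)"
  proof (rule nn_integral_mono)
    fix x assume "x \<in> space M"
    have "(\<Sum>k\<in>K. indicator E (T k x) :: ennreal) = of_nat (card {k \<in> K. T k x \<in> E})"
      using K by (simp add: indicator_def sum.If_cases Int_def)
    also have "\<dots> \<le> of_nat c" using hits[OF \<open>x \<in> space M\<close>] by simp
    finally show "(\<Sum>k\<in>K. indicator E (T k x) :: ennreal) \<le> of_nat c" .
  qed
  also have "\<dots> = of_nat c" by (simp add: total)
  finally have "ennreal (real (card K) * measure M E) \<le> ennreal (real c)"
    by (simp add: emeasure_eq_measure ennreal_mult ennreal_of_nat_eq_real_of_nat)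
  then show ?thesis by simp
qed

lemma continuous_on_matrix_mult [continuous_intros]:
  fixes f :: "'a::topological_space \<Rightarrow> real^'m^'n" and g :: "'a \<Rightarrow> real^'k^'m"
  assumes "continuous_on S f" "continuous_on S g"
  shows "continuous_on S (\<lambda>x. f x ** g x)"
  unfolding matrix_matrix_mult_def using assms by (intro continuous_intros)

lemma borel_measurable_matrix_mult:
  fixes f :: "'a \<Rightarrow> real^'m^'n" and g :: "'a \<Rightarrow> real^'k^'m"
  assumes "f \<in> borel_measurable M" "g \<in> borel_measurable M"
  shows "(\<lambda>x. f x ** g x) \<in> borel_measurable M"
  by (rule borel_measurable_continuous_Pair[OF assms]) (intro continuous_intros)

lemma borel_measurable_transpose:
  fixes f :: "'a \<Rightarrow> real^'m^'n"
  assumes "f \<in> borel_measurable M"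
  shows "(\<lambda>x. transpose (f x)) \<in> borel_measurable M"
proof (rule borel_measurable_continuous_on[OF _ assms])
  show "continuous_on UNIV (transpose :: real^'m^'n \<Rightarrow> _)"
    unfolding transpose_def by (intro continuous_intros)
qed

locale haar_SO3 =
  fixes \<mu> :: "(real^3^3) measure"
  assumes haar: "haar_measure_SO3 \<mu>"
begin

lemma sets_haar: "sets \<mu> = sets (restrict_space borel SO3)"
  and total_haar: "emeasure \<mu> SO3 = 1"
  and invariant: "X \<in> SO3 \<Longrightarrow> E \<in> sets \<mu> \<Longrightarrow> emeasure \<mu> ((\<lambda>Y. X ** Y) ` E) = emeasure \<mu> E"
  using haar by (auto simp: haar_measure_SO3_def)

lemma space_haar: "space \<mu> = SO3"
  using sets_eq_imp_space_eq[OF sets_haar] by (simp add: space_restrict_space)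

sublocale finite_measure \<mu>
  by standard (simp add: space_haar total_haar)

lemma measurable_translation:
  assumes "X \<in> SO3"
  shows "(\<lambda>Y. X ** Y) \<in> measurable \<mu> \<mu>"
proof -
  have "(\<lambda>Y. X ** Y) \<in> measurable (restrict_space borel SO3) (restrict_space borel SO3)"
    using assms
    by (intro measurable_restrict_space2 borel_measurable_continuous_on_restrict continuous_intros)
       (auto simp: space_restrict_space SO3_mult)
  then show ?thesis by (simp add: measurable_cong_sets[OF sets_haar sets_haar])
qed

lemma distr_translation:
  assumes "X \<in> SO3"
  shows "distr \<mu> \<mu> (\<lambda>Y. X ** Y) = \<mu>"
proof (rule measure_eqI)
  fix E assume "E \<in> sets (distr \<mu> \<mu> (\<lambda>Y. X ** Y))"
  then have E: "E \<in> sets \<mu>" by simp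
  then have sub: "E \<subseteq> SO3" using sets.sets_into_space space_haar by blast
  have "(\<lambda>Y. X ** Y) -` E \<inter> space \<mu> = (\<lambda>Y. transpose X ** Y) ` E"
  proof (intro equalityI subsetI)
    fix Y assume "Y \<in> (\<lambda>Y. X ** Y) -` E \<inter> space \<mu>"
    then have "X ** Y \<in> E" "Y = transpose X ** (X ** Y)"
      by (auto simp: matrix_mul_assoc SO3_transpose_inverse[OF assms])
    then show "Y \<in> (\<lambda>Y. transpose X ** Y) ` E" by (rule rev_image_eqI)
  next
    fix Y assume "Y \<in> (\<lambda>Y. transpose X ** Y) ` E"
    then obtain Z where Z: "Z \<in> E" "Y = transpose X ** Z" by blast
    then have "Y \<in> SO3" using sub assms SO3_mult SO3_transpose by blast
    moreover have "X ** Y = Z"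
      by (simp add: Z matrix_mul_assoc SO3_transpose_inverse[OF assms])
    ultimately show "Y \<in> (\<lambda>Y. X ** Y) -` E \<inter> space \<mu>" using Z by (simp add: space_haar)
  qed
  then show "emeasure (distr \<mu> \<mu> (\<lambda>Y. X ** Y)) E = emeasure \<mu> E"
    using E invariant[OF SO3_transpose[OF assms] E]
    by (simp add: emeasure_distr[OF measurable_translation[OF assms]])
qed simp

abbreviation pairs :: "((real^3^3) \<times> (real^3^3)) measure" where
  "pairs \<equiv> \<mu> \<Otimes>\<^sub>M \<mu>"

lemma space_pairs: "space pairs = SO3 \<times> SO3"
  by (simp add: space_pair_measure space_haar)

lemma total_pairs: "emeasure pairs (space pairs) = 1"
proof -
  have "SO3 \<in> sets \<mu>" using sets.top[of \<mu>] by (simp add: space_haar)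
  then show ?thesis by (simp add: space_pairs emeasure_pair_measure_Times total_haar)
qed

sublocale pairs: finite_measure pairs
  by standard (simp add: total_pairs)

lemma translation_preserves_pairs:
  assumes "X \<in> SO3" "Y \<in> SO3"
  defines "T \<equiv> \<lambda>(A, B). (X ** A, Y ** B)"
  shows "T \<in> measurable pairs pairs" "distr pairs pairs T = pairs"
proof -
  note T = measurable_translation[OF assms(1)] measurable_translation[OF assms(2)]
  show "T \<in> measurable pairs pairs"
    unfolding T_def split_beta
    by (intro measurable_Pair measurable_compose[OF measurable_fst T(1)]
        measurable_compose[OF measurable_snd T(2)])
  have "sigma_finite_measure (distr \<mu> \<mu> (\<lambda>B. Y ** B))"
    unfolding distr_translation[OF assms(2)] by (rule sigma_finite_measure_axioms)
  from pair_measure_distr[OF T this] show "distr pairs pairs T = pairs"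
    by (simp add: T_def distr_translation assms)
qed

lemma move_pair_preserves_pairs:
  assumes "set xs \<subseteq> sphere 0 1" "length xs = 6"
  shows "move_pair xs \<in> measurable pairs pairs" "distr pairs pairs (move_pair xs) = pairs"
proof -
  have "xs ! i \<in> sphere 0 1" if "i < 6" for i
  proof -
    have "xs ! i \<in> set xs" using that assms(2) by (intro nth_mem) simp
    then show ?thesis using assms(1) by blast
  qed
  then have "euler (xs!0) (xs!1) (xs!2) \<in> SO3" "euler (xs!3) (xs!4) (xs!5) \<in> SO3"
    by (auto intro!: euler_SO3)
  from translation_preserves_pairs[OF this]
  show "move_pair xs \<in> measurable pairs pairs" "distr pairs pairs (move_pair xs) = pairs"
    by (simp_all add: move_pair_def)
qed

lemma measurable_projections:
  "fst \<in> borel_measurable pairs" "snd \<in> borel_measurable pairs"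
proof -
  have "(\<lambda>X. X) \<in> borel_measurable \<mu>"
    by (subst measurable_cong_sets[OF sets_haar refl]) (rule measurable_restrict_space1, simp)
  then show "fst \<in> borel_measurable pairs" "snd \<in> borel_measurable pairs"
    using measurable_compose[OF measurable_fst, of "\<lambda>X. X" \<mu> borel \<mu>]
      measurable_compose[OF measurable_snd, of "\<lambda>X. X" \<mu> borel \<mu>] by simp_all
qed

lemma borel_measurable_powi:
  assumes "f \<in> borel_measurable pairs" "\<And>p. p \<in> space pairs \<Longrightarrow> f p \<in> SO3"
  shows "(\<lambda>p. mat_powi (f p) k) \<in> borel_measurable pairs"
proof -
  have power: "(\<lambda>p. ((**) (g p) ^^ n) (mat 1)) \<in> borel_measurable pairs"
    if "g \<in> borel_measurable pairs" for n and g :: "_ \<Rightarrow> real^3^3"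
    by (induction n) (use that in \<open>auto intro: borel_measurable_matrix_mult\<close>)
  have "(\<lambda>p. ((**) (if 0 \<le> k then f p else transpose (f p)) ^^ nat \<bar>k\<bar>) (mat 1))
      \<in> borel_measurable pairs"
    using assms(1) borel_measurable_transpose[OF assms(1)]
    by (intro power) (cases "0 \<le> k"; simp)
  then show ?thesis
    by (subst measurable_cong[OF mat_powi_SO3[OF assms(2)]])
qed

lemma borel_measurable_word: "(\<lambda>p. word I (fst p) (snd p)) \<in> borel_measurable pairs"
proof (induction I)
  case (Cons sr I)
  obtain s r where "sr = (s, r)" by force
  then show ?case
    using Cons by (auto intro!: borel_measurable_matrix_mult borel_measurable_powi
        measurable_projections simp: space_pairs)
qed simp

text \<open>
  Closeness is measured entrywise because a single entry is what the counting argument controls; being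
  close to \<open>C\<close> in all entries is the smaller set.
\<close>

definition near :: "real^3^3 \<Rightarrow> (int \<times> int) list \<Rightarrow> real \<Rightarrow> ((real^3^3) \<times> (real^3^3)) set" where
  "near C I \<epsilon> = {p \<in> space pairs. \<forall>i j. \<bar>word I (fst p) (snd p) $ i $ j - C $ i $ j\<bar> < \<epsilon>}"

lemma sets_near: "near C I \<epsilon> \<in> sets pairs"
proof -
  have "(\<lambda>p. word I (fst p) (snd p) $ i $ j) \<in> borel_measurable pairs" for i j
  proof (rule borel_measurable_continuous_on[OF _ borel_measurable_word])
    show "continuous_on UNIV (\<lambda>X :: real^3^3. X $ i $ j)" by (intro continuous_intros)
  qed
  then show ?thesis unfolding near_def by measurable
qed

text \<open>
  Average over the \<open>N\<^sup>6\<close> moves whose angles come from \<open>circle_net N\<close>.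
\<close>

lemma measure_near_le:
  assumes A': "A' \<in> SO3" "B' \<in> SO3"
    and \<delta>: "0 < \<delta>" "\<delta> \<le> \<bar>word I A' B' $ i $ j - C $ i $ j\<bar>"
    and n: "index_length I = int n" and N: "N > 0"
  shows "measure pairs (near C I (\<delta> * (1 / (4 * real N + 1)) ^ (12 * n))) \<le> 12 * real n / real N"
proof -
  define K where "K = {xs. set xs \<subseteq> circle_net N \<and> length xs = 6}"
  define \<epsilon> where "\<epsilon> = \<delta> * (1 / (4 * real N + 1)) ^ (12 * n)"
  let ?E = "near C I \<epsilon>"
  have K: "finite K" "card K = N ^ 6"
    using finite_lists_length_eq[OF finite_circle_net] card_lists_length_eq[OF finite_circle_net]
    by (simp_all add: K_def card_circle_net)
  have sphere: "set xs \<subseteq> sphere 0 1" "length xs = 6" if "xs \<in> K" for xs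
    using that circle_net_sphere by (auto simp: K_def)
  have hits: "card {xs \<in> K. move_pair xs p \<in> ?E} \<le> 12 * n * N ^ 5" if p_space: "p \<in> space pairs" for p
  proof -
    obtain A B where p: "p = (A, B)" "A \<in> SO3" "B \<in> SO3"
      using p_space unfolding space_pairs by blast
    let ?f = "\<lambda>(A, B). word I A B $ i $ j - C $ i $ j"
    let ?S = "{xs. set xs \<subseteq> circle_net N \<and> length xs = 6 \<and> \<bar>?f (move_pair xs (A, B))\<bar> < \<epsilon>}"
    have "{xs \<in> K. move_pair xs p \<in> ?E} \<subseteq> ?S"
      by (auto simp: near_def K_def p split_beta)
    moreover have "finite ?S"
      by (rule finite_subset[OF _ K(1)]) (auto simp: K_def)
    ultimately have "card {xs \<in> K. move_pair xs p \<in> ?E} \<le> card ?S"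
      by (intro card_mono)
    moreover have "N * card ?S \<le> N * (12 * n * N ^ 5)"
      using card_translates_small_entry_le[OF p(2,3) A' \<delta>(1) _ n N, of i j C] \<delta>(2)
      by (simp add: \<epsilon>_def eval_nat_numeral ac_simps)
    then have "card ?S \<le> 12 * n * N ^ 5" using N by simp
    ultimately show ?thesis by linarith
  qed
  have "real (card K) * measure pairs ?E \<le> real (12 * n * N ^ 5)"
    by (rule measure_le_by_averaging[OF total_pairs sets_near K(1)
          move_pair_preserves_pairs(1)[OF sphere] move_pair_preserves_pairs(2)[OF sphere] hits])
  then have "real N ^ 5 * (real N * measure pairs ?E) \<le> real N ^ 5 * (12 * real n)"
    by (simp add: K(2) eval_nat_numeral ac_simps)
  then have "real N * measure pairs ?E \<le> 12 * real n" using N by simp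
  then show ?thesis using N by (simp add: \<epsilon>_def field_simps)
qed

text \<open>
  With \<open>N = L\<^sup>n\<close>, the bound \<open>12 n / L\<^sup>n\<close> for a single word outweighs the number \<open>3\<^sup>n\<close> of words; the
  base \<open>6\<close> comes from \<open>3\<close> and the crude estimate \<open>n \<le> 2\<^sup>n\<close>.
\<close>

lemma measure_near_words_le:
  assumes \<delta>: "0 < \<delta>"
    "\<And>I n. multi_index I \<Longrightarrow> index_length I = int n \<Longrightarrow> n \<ge> 1 \<Longrightarrow>
       \<exists>A\<in>SO3. \<exists>B\<in>SO3. \<exists>i j. \<delta> ^ n \<le> \<bar>word I A B $ i $ j - C $ i $ j\<bar>"
    and n: "n \<ge> 1" and L: "L > 0"
  defines "W \<equiv> {I. multi_index I \<and> index_length I = int n}"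
  shows "measure pairs (\<Union>I\<in>W. near C I (\<delta> ^ n * (1 / (4 * real (L ^ n) + 1)) ^ (12 * n)))
           \<le> 12 * (6 / real L) ^ n"
proof -
  let ?E = "\<lambda>I. near C I (\<delta> ^ n * (1 / (4 * real (L ^ n) + 1)) ^ (12 * n))"
  have W: "finite W" "card W \<le> 3 ^ n"
    using card_multi_index_le[of n] by (auto simp: W_def)
  have "measure pairs (?E I) \<le> 12 * real n / real (L ^ n)" if "I \<in> W" for I
  proof -
    have I: "multi_index I" "index_length I = int n" using that by (auto simp: W_def)
    obtain A B i j where "A \<in> SO3" "B \<in> SO3" "\<delta> ^ n \<le> \<bar>word I A B $ i $ j - C $ i $ j\<bar>"
      using \<delta>(2)[OF I n] by blast
    then show ?thesis using \<delta>(1) I(2) L by (intro measure_near_le) auto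
  qed
  then have "measure pairs (\<Union>I\<in>W. ?E I) \<le> (\<Sum>I\<in>W. 12 * real n / real (L ^ n))"
    using W(1) sets_near
    by (intro order_trans[OF pairs.finite_measure_subadditive_finite] sum_mono) auto
  also have "\<dots> = real (card W) * (12 * real n / real (L ^ n))" by simp
  also have "\<dots> \<le> 3 ^ n * (12 * 2 ^ n / real (L ^ n))"
  proof (intro mult_mono divide_right_mono)
    show "real (card W) \<le> 3 ^ n" using W(2) by (metis of_nat_le_iff of_nat_numeral of_nat_power)
    show "real n \<le> 2 ^ n" using of_nat_less_two_power[of n, where 'a = real] by simp
  qed auto
  also have "\<dots> = 12 * (6 / real L) ^ n"
    by (simp add: power_divide flip: power_mult_distrib)
  finally show ?thesis .
qed

end


section \<open>The Diophantine estimate\<close>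

text \<open>
  Here the exponent \<open>n\<^sup>2\<close> arises: the threshold is a power of \<open>L\<^sup>n\<close>, with an exponent linear in \<open>n\<close>.
\<close>

lemma threshold_le:
  fixes \<kappa> \<delta> :: real and n L :: nat
  assumes \<kappa>: "0 < \<kappa>" "\<kappa> \<le> 1" and \<delta>: "0 < \<delta>" "\<delta> \<le> 1" and n: "n \<ge> 1" and L: "L \<ge> 1"
  shows "(\<kappa> * \<delta> / (5 * real L) ^ 12) ^ n\<^sup>2
           \<le> \<kappa> * (\<delta> ^ n * (1 / (4 * real (L ^ n) + 1)) ^ (12 * n))"
proof -
  have nn: "n \<le> n\<^sup>2" "1 \<le> n\<^sup>2" using n by (auto simp: power2_eq_square)
  have "1 \<le> real L ^ n" using L by simp
  then have "4 * real (L ^ n) + 1 \<le> 5 * real L ^ n" by simp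
  also have "\<dots> \<le> 5 ^ n * real L ^ n"
    using self_le_power[of "5 :: real" n] n by (intro mult_right_mono) auto
  finally have "(4 * real (L ^ n) + 1) ^ (12 * n) \<le> ((5 * real L) ^ n) ^ (12 * n)"
    by (intro power_mono) (auto simp: power_mult_distrib)
  also have "\<dots> = ((5 * real L) ^ 12) ^ n\<^sup>2"
  proof -
    have "n * (12 * n) = 12 * n\<^sup>2" by (simp add: power2_eq_square)
    then show ?thesis by (simp only: flip: power_mult)
  qed
  finally have "(1 / (5 * real L) ^ 12) ^ n\<^sup>2 \<le> (1 / (4 * real (L ^ n) + 1)) ^ (12 * n)"
    using L by (simp add: power_one_over frac_le add_nonneg_pos)
  moreover have "\<kappa> ^ n\<^sup>2 \<le> \<kappa>" using power_decreasing[OF nn(2), of \<kappa>] \<kappa> by simp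
  moreover have "\<delta> ^ n\<^sup>2 \<le> \<delta> ^ n" using nn(1) \<delta> by (intro power_decreasing) auto
  ultimately have "\<kappa> ^ n\<^sup>2 * (\<delta> ^ n\<^sup>2 * (1 / (5 * real L) ^ 12) ^ n\<^sup>2)
      \<le> \<kappa> * (\<delta> ^ n * (1 / (4 * real (L ^ n) + 1)) ^ (12 * n))"
    using \<kappa> \<delta> by (intro mult_mono) auto
  then show ?thesis by (simp add: power_mult_distrib power_divide)
qed

theorem theorem1:
  fixes \<mu> :: "(real^3^3) measure"
    and N :: "real^3^3 \<Rightarrow> real"
    and C :: "real^3^3"
  assumes "haar_measure_SO3 \<mu>"
    and "norm_on_matrices N"
    and "C \<in> SO3"
  shows "AE (A, B) in \<mu> \<Otimes>\<^sub>M \<mu>.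
           \<exists>D>0. \<forall>n::nat. n \<ge> 1 \<longrightarrow>
             (\<forall>I. multi_index I \<and> index_length I = int n \<longrightarrow>
                N (word I A B - C) \<ge> D powi (- (int n ^ 2)))"
proof -
  interpret haar_SO3 \<mu> by standard (rule assms(1))
  obtain \<kappa> where \<kappa>: "0 < \<kappa>" "\<kappa> \<le> 1" "\<And>X i j. \<kappa> * \<bar>X $ i $ j\<bar> \<le> N X"
    using norm_on_matrices_dominates_entries[OF assms(2)] by blast
  obtain \<delta> where \<delta>: "0 < \<delta>" "\<delta> \<le> 1"
    "\<And>I n. multi_index I \<Longrightarrow> index_length I = int n \<Longrightarrow> n \<ge> 1 \<Longrightarrow>
       \<exists>A\<in>SO3. \<exists>B\<in>SO3. \<exists>i j. \<delta> ^ n \<le> \<bar>word I A B $ i $ j - C $ i $ j\<bar>"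
    using word_far_from_target by metis
  define \<epsilon> where "\<epsilon> L n = \<delta> ^ n * (1 / (4 * real (L ^ n) + 1)) ^ (12 * n)" for L n :: nat
  define W where "W n = {I. multi_index I \<and> index_length I = int n}" for n
  \<comment> \<open>the level \<open>L = l + 7\<close> exceeds 6, so that the geometric series in \<open>6 / L\<close> converges\<close>
  define bad where "bad l = (\<Union>n. \<Union>I\<in>W (Suc n). near C I (\<epsilon> (l + 7) (Suc n)))" for l
  have finW: "finite (W n)" for n using card_multi_index_le[of n] by (simp add: W_def)
  have sets_level: "(\<Union>I\<in>W n. near C I e) \<in> sets pairs" for n e
    by (intro sets.finite_UN finW sets_near)
  have sets_bad: "bad l \<in> sets pairs" for l
    unfolding bad_def by (intro sets.countable_UN') (auto simp: sets_level)
  have measure_bad: "measure pairs (bad l) \<le> 72 / real (Suc l)" for l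
  proof -
    define q where "q = 6 / real (l + 7)"
    have "1 - q = real (Suc l) / real (l + 7)" by (simp add: q_def field_simps)
    moreover have "12 * (6 / m) * (1 / (s / m)) = 72 / s" if "m > 0" for m s :: real
      using that by simp
    ultimately have "12 * q * (1 / (1 - q)) = 72 / real (Suc l)"
      by (simp only: q_def)
    moreover have "0 \<le> q" "q < 1" by (simp_all add: q_def)
    ultimately have q: "0 \<le> q" "q < 1" "12 * q * (1 / (1 - q)) = 72 / real (Suc l)"
      by blast+
    let ?E = "\<lambda>n. \<Union>I\<in>W (Suc n). near C I (\<epsilon> (l + 7) (Suc n))"
    have le: "measure pairs (?E n) \<le> 12 * q * q ^ n" for n
      using measure_near_words_le[OF \<delta>(1,3), of "Suc n" "l + 7"]
      by (simp add: W_def \<epsilon>_def q_def)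
    have geom: "(\<lambda>n. 12 * q * q ^ n) sums (12 * q * (1 / (1 - q)))"
      using q by (intro sums_mult geometric_sums) auto
    have summable: "summable (\<lambda>n. measure pairs (?E n))"
      by (rule summable_comparison_test'[OF sums_summable[OF geom]]) (use le in auto)
    have "measure pairs (bad l) \<le> (\<Sum>n. measure pairs (?E n))"
      unfolding bad_def
      by (intro pairs.finite_measure_subadditive_countably summable)
         (auto simp: sets_level)
    also have "\<dots> \<le> (\<Sum>n. 12 * q * q ^ n)"
      by (rule suminf_le[OF le summable sums_summable[OF geom]])
    also have "\<dots> = 72 / real (Suc l)" using geom q(3) by (simp add: sums_iff)
    finally show ?thesis .
  qed
  have sets_Inter: "(\<Inter>l. bad l) \<in> sets pairs"
    using sets_bad by (intro sets.countable_INT') auto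
  have "measure pairs (\<Inter>l. bad l) \<le> 72 / real (Suc l)" for l
  proof -
    have "(\<Inter>l. bad l) \<subseteq> bad l" by blast
    from pairs.finite_measure_mono[OF this sets_bad] measure_bad[of l] show ?thesis by linarith
  qed
  moreover have "(\<lambda>l. 72 / real (Suc l)) \<longlonglongrightarrow> 0"
    using LIMSEQ_Suc[OF lim_const_over_n[of 72]] by simp
  ultimately have "measure pairs (\<Inter>l. bad l) \<le> 0"
    by (intro LIMSEQ_le_const) auto
  then have "measure pairs (\<Inter>l. bad l) = 0" using measure_nonneg[of pairs] by (simp add: antisym)
  then have "(\<Inter>l. bad l) \<in> null_sets pairs"
    using sets_Inter by (simp add: null_sets_def pairs.emeasure_eq_measure)
  then have "AE p in pairs. p \<notin> (\<Inter>l. bad l)" by (rule AE_not_in)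
  then show ?thesis
  proof (rule AE_mp, intro AE_I2 impI, clarsimp)
    fix A B l assume AB: "(A, B) \<in> space pairs" "(A, B) \<notin> bad l"
    define D where "D = (5 * real (l + 7)) ^ 12 / (\<kappa> * \<delta>)"
    have "D > 0" using \<kappa> \<delta> by (simp add: D_def)
    moreover have "D powi (- (int n ^ 2)) \<le> N (word I A B - C)"
      if n: "1 \<le> n" and I: "multi_index I" "index_length I = int n" for n I
    proof -
      have "(A, B) \<notin> near C I (\<epsilon> (l + 7) n)"
        using AB(2) n I by (cases n) (auto simp: bad_def W_def)
      then obtain i j where ij: "\<epsilon> (l + 7) n \<le> \<bar>(word I A B - C) $ i $ j\<bar>"
        using AB(1) by (auto simp: near_def not_less)
      have "D powi (- (int n ^ 2)) = inverse (D powi int (n\<^sup>2))"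
        by (simp add: power_int_minus)
      also have "\<dots> = (\<kappa> * \<delta> / (5 * real (l + 7)) ^ 12) ^ n\<^sup>2"
        unfolding power_int_of_nat by (simp add: D_def flip: power_inverse)
      also have "\<dots> \<le> \<kappa> * \<epsilon> (l + 7) n"
        unfolding \<epsilon>_def using \<kappa> \<delta> n by (intro threshold_le) auto
      also have "\<dots> \<le> \<kappa> * \<bar>(word I A B - C) $ i $ j\<bar>"
        using ij \<kappa>(1) by simp
      also have "\<dots> \<le> N (word I A B - C)" by (rule \<kappa>(3))
      finally show ?thesis .
    qed
    ultimately show "\<exists>D>0. \<forall>n\<ge>Suc 0. \<forall>I. multi_index I \<and> index_length I = int n \<longrightarrow>
        D powi - (int n)\<^sup>2 \<le> N (word I A B - C)"
      by (intro exI[of _ D]) auto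
  qed
qed

end
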